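(* Let $L$ be a complete lattice and let $((Q,\cdot),E)$ be an $L$-groupoid which is an $L$-quasigroup. Let $\backslash$ and $/$ be binary operations on $Q$ defined using the Axiom of Choice by choosing, for every pair $a,b\in Q$ and with $p=\mu(a)\wedge\mu(b)$, an element $a\backslash b\in[a]_{E_p}\backslash[b]_{E_p}$ and an element $b/a\in[b]_{E_p}/[a]_{E_p}$. Then the structure $((Q,\cdot,\backslash,/),E)$ is an $L$-equasigroup.
   Context: $(L,\wedge,\vee,\leqslant)$ is a complete lattice with top $1$ and bottom $0$. An $L$-valued equality on a nonempty set $Q$ is a map $E:Q^2\to L$ with $E(x,y)=E(y,x)$; $E(x,z)\wedge E(z,y)\leqslant E(x,y)$; and $E(x,y)=1$ implies $x=y$. Reflexivity $E(x,x)=1$ is not assumed. It is compatible with a binary operation $*$ on $Q$ if $E(x,y)\wedge E(u,v)\leqslant E(x*u,y*v)$ for all $x,y,u,v\in Q$. An $L$-groupoid is a pair $((Q,\cdot),E)$ where $\cdot$ is a binary operation on $Q$ and $E$ is an $L$-valued equality compatible with $\cdot$. Put $\mu(x)=E(x,x)$; for $p\in L$ let $\mu_p=\{x\in Q\mid\mu(x)\geqslant p\}$ and $E_p=\{(x,y)\in Q^2\mid E(x,y)\geqslant p\}$. Then $\mu_p$ is closed under $\cdot$, $E_p$ is a congruence on $\mu_p$, and $\mu_p/E_p$ is the quotient groupoid. For $a,b\in Q$: $c\in Q$ is a solution of $a\cdot x=b$ if $\mu(a)\wedge\mu(b)\leqslant\mu(c)\wedge E(a\cdot c,b)$; $d\in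 Q$ is a solution of $y\cdot a=b$ if $\mu(a)\wedge\mu(b)\leqslant\mu(d)\wedge E(d\cdot a,b)$. The equation $a\cdot x=b$ is $E$-uniquely solvable if it has a solution and, for every solution $c$, every $p\leqslant\mu(a)\wedge\mu(b)$ and every $c_1\in Q$ with $E(a\cdot c_1,b)\geqslant p$, one has $E(c,c_1)\geqslant p$. Analogously, $y\cdot a=b$ is $E$-uniquely solvable if it has a solution and, for every solution $d$, every $p\leqslant\mu(a)\wedge\mu(b)$ and every $d_1\in Q$ with $E(d_1\cdot a,b)\geqslant p$, one has $E(d,d_1)\geqslant p$. The $L$-groupoid is an $L$-quasigroup if both equations are $E$-uniquely solvable for all $a,b\in Q$. If $((Q,\cdot),E)$ is an $L$-quasigroup then each $\mu_p/E_p$ is a classical quasigroup (unique solvability of $A\cdot X=B$ and $Y\cdot A=B$). In it, $[a]_{E_p}\backslash[b]_{E_p}$ denotes the unique class $[c]_{E_p}$ with $[a]_{E_p}\cdot[c]_{E_p}=[b]_{E_p}$, and $[b]_{E_p}/[a]_{E_p}$ the unique class $[d]_{E_p}$ with $[d]_{E_p}\cdot[a]_{E_p}=[b]_{E_p}$. $L$-equasigroup: a pair $((Q,\cdot,\backslash,/),E)$ where $E$ is an $L$-valued equality on $Q$ compatible with all three binary operations, and for all $x,y\in Q$ the element $\mu(x)\wedge\mu(y)$ is below (i.e. $\leqslant$) each of $E(y,x\cdot(x\backslash y))$, $E(y,x\backslash(x\cdot y))$, $E(y,(y/x)\cdot x)$, $E(y,(y\cdot x)/x)$. *)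

theory Defs
  imports Main
begin

text \<open>
  The lattice is a type of class \<^class>\<open>complete_lattice\<close>; the set \<open>Q\<close> is an explicit carrier, and all
  operations and lattice-valued relations are total functions that only matter on \<open>Q\<close>.
\<close>

definition closed_op :: "'a set \<Rightarrow> ('a \<Rightarrow> 'a \<Rightarrow> 'a) \<Rightarrow> bool" where
  "closed_op Q f \<longleftrightarrow> (\<forall>x\<in>Q. \<forall>y\<in>Q. f x y \<in> Q)"

text \<open>Reflexivity \<open>E x x = top\<close> is deliberately not part of the definition.\<close>

definition L_equality :: "'a set \<Rightarrow> ('a \<Rightarrow> 'a \<Rightarrow> 'l::complete_lattice) \<Rightarrow> bool" where
  "L_equality Q E \<longleftrightarrow>
     Q \<noteq> {} \<and>
     (\<forall>x\<in>Q. \<forall>y\<in>Q. E x y = E y x) \<and>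
     (\<forall>x\<in>Q. \<forall>y\<in>Q. \<forall>z\<in>Q. inf (E x z) (E z y) \<le> E x y) \<and>
     (\<forall>x\<in>Q. \<forall>y\<in>Q. E x y = top \<longrightarrow> x = y)"

definition compatible ::
    "'a set \<Rightarrow> ('a \<Rightarrow> 'a \<Rightarrow> 'l::complete_lattice) \<Rightarrow> ('a \<Rightarrow> 'a \<Rightarrow> 'a) \<Rightarrow> bool" where
  "compatible Q E f \<longleftrightarrow>
     (\<forall>x\<in>Q. \<forall>y\<in>Q. \<forall>u\<in>Q. \<forall>v\<in>Q. inf (E x y) (E u v) \<le> E (f x u) (f y v))"

definition L_groupoid ::
    "'a set \<Rightarrow> ('a \<Rightarrow> 'a \<Rightarrow> 'a) \<Rightarrow> ('a \<Rightarrow> 'a \<Rightarrow> 'l::complete_lattice) \<Rightarrow> bool" where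
  "L_groupoid Q f E \<longleftrightarrow> closed_op Q f \<and> L_equality Q E \<and> compatible Q E f"

definition mu :: "('a \<Rightarrow> 'a \<Rightarrow> 'l) \<Rightarrow> 'a \<Rightarrow> 'l" where
  "mu E x = E x x"

definition mu_cut :: "'a set \<Rightarrow> ('a \<Rightarrow> 'a \<Rightarrow> 'l::complete_lattice) \<Rightarrow> 'l \<Rightarrow> 'a set" where
  "mu_cut Q E p = {x \<in> Q. p \<le> mu E x}"

definition E_cut :: "'a set \<Rightarrow> ('a \<Rightarrow> 'a \<Rightarrow> 'l::complete_lattice) \<Rightarrow> 'l \<Rightarrow> ('a \<times> 'a) set" where
  "E_cut Q E p = {(x, y) \<in> Q \<times> Q. p \<le> E x y}"

definition E_class :: "'a set \<Rightarrow> ('a \<Rightarrow> 'a \<Rightarrow> 'l::complete_lattice) \<Rightarrow> 'l \<Rightarrow> 'a \<Rightarrow> 'a set" where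
  "E_class Q E p x = E_cut Q E p `` {x}"

definition quotient_groupoid ::
    "'a set \<Rightarrow> ('a \<Rightarrow> 'a \<Rightarrow> 'l::complete_lattice) \<Rightarrow> 'l \<Rightarrow> 'a set set" where
  "quotient_groupoid Q E p = mu_cut Q E p // E_cut Q E p"

text \<open>
  The operation of the quotient groupoid. As \<^term>\<open>E_cut Q E p\<close> is a congruence on \<^term>\<open>mu_cut Q E p\<close>,
  all members of the union coincide when \<open>A\<close> and \<open>B\<close> are classes of elements of \<^term>\<open>mu_cut Q E p\<close>,
  so \<open>[x] \<cdot> [y] = [x \<cdot> y]\<close>.
\<close>

definition class_op ::
    "'a set \<Rightarrow> ('a \<Rightarrow> 'a \<Rightarrow> 'a) \<Rightarrow> ('a \<Rightarrow> 'a \<Rightarrow> 'l::complete_lattice) \<Rightarrow> 'l \<Rightarrow>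
      'a set \<Rightarrow> 'a set \<Rightarrow> 'a set" where
  "class_op Q f E p A B = (\<Union>x\<in>A. \<Union>y\<in>B. E_class Q E p (f x y))"

text \<open>
  The divisions \<open>A\B\<close> and \<open>B/A\<close> of the quotient groupoid. The descriptions are meaningful for an
  \<open>L\<close>-quasigroup, where the quotient groupoid is a quasigroup.
\<close>

definition class_ldiv ::
    "'a set \<Rightarrow> ('a \<Rightarrow> 'a \<Rightarrow> 'a) \<Rightarrow> ('a \<Rightarrow> 'a \<Rightarrow> 'l::complete_lattice) \<Rightarrow> 'l \<Rightarrow>
      'a set \<Rightarrow> 'a set \<Rightarrow> 'a set" where
  "class_ldiv Q f E p A B = (THE C. C \<in> quotient_groupoid Q E p \<and> class_op Q f E p A C = B)"

definition class_rdiv ::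
    "'a set \<Rightarrow> ('a \<Rightarrow> 'a \<Rightarrow> 'a) \<Rightarrow> ('a \<Rightarrow> 'a \<Rightarrow> 'l::complete_lattice) \<Rightarrow> 'l \<Rightarrow>
      'a set \<Rightarrow> 'a set \<Rightarrow> 'a set" where
  "class_rdiv Q f E p B A = (THE D. D \<in> quotient_groupoid Q E p \<and> class_op Q f E p D A = B)"

definition left_solution ::
    "'a set \<Rightarrow> ('a \<Rightarrow> 'a \<Rightarrow> 'a) \<Rightarrow> ('a \<Rightarrow> 'a \<Rightarrow> 'l::complete_lattice) \<Rightarrow> 'a \<Rightarrow> 'a \<Rightarrow> 'a \<Rightarrow> bool" where
  "left_solution Q f E a b c \<longleftrightarrow>
     c \<in> Q \<and> inf (mu E a) (mu E b) \<le> inf (mu E c) (E (f a c) b)"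

definition right_solution ::
    "'a set \<Rightarrow> ('a \<Rightarrow> 'a \<Rightarrow> 'a) \<Rightarrow> ('a \<Rightarrow> 'a \<Rightarrow> 'l::complete_lattice) \<Rightarrow> 'a \<Rightarrow> 'a \<Rightarrow> 'a \<Rightarrow> bool" where
  "right_solution Q f E a b d \<longleftrightarrow>
     d \<in> Q \<and> inf (mu E a) (mu E b) \<le> inf (mu E d) (E (f d a) b)"

definition left_E_uniquely_solvable ::
    "'a set \<Rightarrow> ('a \<Rightarrow> 'a \<Rightarrow> 'a) \<Rightarrow> ('a \<Rightarrow> 'a \<Rightarrow> 'l::complete_lattice) \<Rightarrow> 'a \<Rightarrow> 'a \<Rightarrow> bool" where
  "left_E_uniquely_solvable Q f E a b \<longleftrightarrow>
     (\<exists>c. left_solution Q f E a b c) \<and>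
     (\<forall>c p c1. left_solution Q f E a b c \<longrightarrow> p \<le> inf (mu E a) (mu E b) \<longrightarrow> c1 \<in> Q \<longrightarrow>
        p \<le> E (f a c1) b \<longrightarrow> p \<le> E c c1)"

definition right_E_uniquely_solvable ::
    "'a set \<Rightarrow> ('a \<Rightarrow> 'a \<Rightarrow> 'a) \<Rightarrow> ('a \<Rightarrow> 'a \<Rightarrow> 'l::complete_lattice) \<Rightarrow> 'a \<Rightarrow> 'a \<Rightarrow> bool" where
  "right_E_uniquely_solvable Q f E a b \<longleftrightarrow>
     (\<exists>d. right_solution Q f E a b d) \<and>
     (\<forall>d p d1. right_solution Q f E a b d \<longrightarrow> p \<le> inf (mu E a) (mu E b) \<longrightarrow> d1 \<in> Q \<longrightarrow>
        p \<le> E (f d1 a) b \<longrightarrow> p \<le> E d d1)"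

definition L_quasigroup ::
    "'a set \<Rightarrow> ('a \<Rightarrow> 'a \<Rightarrow> 'a) \<Rightarrow> ('a \<Rightarrow> 'a \<Rightarrow> 'l::complete_lattice) \<Rightarrow> bool" where
  "L_quasigroup Q f E \<longleftrightarrow>
     L_groupoid Q f E \<and>
     (\<forall>a\<in>Q. \<forall>b\<in>Q. left_E_uniquely_solvable Q f E a b \<and> right_E_uniquely_solvable Q f E a b)"

text \<open>Here \<open>ld x y\<close> stands for \<open>x\y\<close> and \<open>rd y x\<close> for \<open>y/x\<close>.\<close>

definition L_equasigroup ::
    "'a set \<Rightarrow> ('a \<Rightarrow> 'a \<Rightarrow> 'a) \<Rightarrow> ('a \<Rightarrow> 'a \<Rightarrow> 'a) \<Rightarrow> ('a \<Rightarrow> 'a \<Rightarrow> 'a) \<Rightarrow>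
      ('a \<Rightarrow> 'a \<Rightarrow> 'l::complete_lattice) \<Rightarrow> bool" where
  "L_equasigroup Q f ld rd E \<longleftrightarrow>
     closed_op Q f \<and> closed_op Q ld \<and> closed_op Q rd \<and>
     L_equality Q E \<and>
     compatible Q E f \<and> compatible Q E ld \<and> compatible Q E rd \<and>
     (\<forall>x\<in>Q. \<forall>y\<in>Q.
        inf (mu E x) (mu E y) \<le> E y (f x (ld x y)) \<and>
        inf (mu E x) (mu E y) \<le> E y (ld x (f x y)) \<and>
        inf (mu E x) (mu E y) \<le> E y (f (rd y x) x) \<and>
        inf (mu E x) (mu E y) \<le> E y (rd (f y x) x))"

end

theory Submission
  imports Defs
begin

text \<open>
  For fixed \<open>a\<close>, \<open>b\<close> and \<open>p = inf (mu E a) (mu E b)\<close>, a solution \<open>c\<close> of \<open>a \<cdot> x = b\<close> represents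
  \<open>[a]\[b]\<close> in the quotient at level \<open>p\<close>, and the members of its class are again solutions. Hence
  choosing \<open>a\b\<close> in \<open>[a]\[b]\<close> amounts to choosing a solution of \<open>a \<cdot> x = b\<close>
  (\<open>choice_from_class_ldiv_is_left_solution\<close>), and the quotients can be forgotten.

  Everything else is one application of uniqueness each time: if \<open>c\<close> is a solution and \<open>c1\<close> satisfies
  the equation \<open>a \<cdot> x = b\<close> to a degree \<open>p\<close> below \<open>inf (mu E a) (mu E b)\<close>, then \<open>p \<le> E c c1\<close>.
  For compatibility of the division, \<open>c1 = a'\b'\<close> satisfies \<open>a \<cdot> x = b\<close> to the degree
  \<open>inf (E a a') (E b b')\<close>, as it satisfies \<open>a' \<cdot> x = b'\<close> at least to that degree
  and compatibility of the multiplication allows \<open>a'\<close> to be exchanged for \<open>a\<close>.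
  For the cancellation law \<open>y \<approx> x\(x \<cdot> y)\<close>, \<open>c1 = y\<close> satisfies \<open>x \<cdot> z = x \<cdot> y\<close> to the degree
  \<open>mu E (x \<cdot> y)\<close>, which is above \<open>inf (mu E x) (mu E y)\<close>. The law \<open>y \<approx> x \<cdot> (x\y)\<close> merely says
  that \<open>x\y\<close> is a solution.

  Right division is left division in the opposite groupoid, so only left division is treated by
  hand.
\<close>

section \<open>Lattice-valued equalities and cuts\<close>

lemma L_equality_sym:
  assumes "L_equality Q E" "x \<in> Q" "y \<in> Q"
  shows "E x y = E y x"
  using assms unfolding L_equality_def by blast

lemma L_equality_trans_cut:
  assumes "L_equality Q E" "x \<in> Q" "y \<in> Q" "z \<in> Q" "p \<le> E x z" "p \<le> E z y"
  shows "p \<le> E x y"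
proof -
  have "p \<le> inf (E x z) (E z y)"
    using assms(5,6) by simp
  also have "\<dots> \<le> E x y"
    using assms(1-4) unfolding L_equality_def by blast
  finally show ?thesis .
qed

text \<open>
  Without reflexivity, \<open>mu E x\<close> bounds the degree to which \<open>x\<close> can equal anything: go from \<open>x\<close> to
  \<open>y\<close> and back.
\<close>

lemma L_equality_le_mu:
  assumes "L_equality Q E" "x \<in> Q" "y \<in> Q" "p \<le> E x y"
  shows "p \<le> mu E x" and "p \<le> mu E y"
proof -
  have "p \<le> E y x"
    using assms L_equality_sym[of Q E x y] by simp
  then show "p \<le> mu E x" and "p \<le> mu E y"
    using assms L_equality_trans_cut[of Q E x x y p] L_equality_trans_cut[of Q E y y x p]
    by (simp_all add: mu_def)
qed

lemma compatible_cut: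
  assumes "compatible Q E f" "x \<in> Q" "y \<in> Q" "u \<in> Q" "v \<in> Q" "p \<le> E x y" "p \<le> E u v"
  shows "p \<le> E (f x u) (f y v)"
proof -
  have "p \<le> inf (E x y) (E u v)"
    using assms(6,7) by simp
  also have "\<dots> \<le> E (f x u) (f y v)"
    using assms(1-5) by (simp add: compatible_def)
  finally show ?thesis .
qed

lemma mem_E_class_iff: "y \<in> E_class Q E p x \<longleftrightarrow> x \<in> Q \<and> y \<in> Q \<and> p \<le> E x y"
  by (auto simp: E_class_def E_cut_def)

lemma E_class_eqI:
  assumes "L_equality Q E" "x \<in> Q" "y \<in> Q" "p \<le> E x y"
  shows "E_class Q E p x = E_class Q E p y"
proof (rule set_eqI)
  fix z
  have "p \<le> E y x"
    using assms L_equality_sym[of Q E] by simp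
  then show "z \<in> E_class Q E p x \<longleftrightarrow> z \<in> E_class Q E p y"
    using assms L_equality_trans_cut[of Q E] unfolding mem_E_class_iff by blast
qed

lemma quotient_groupoid_eq:
  "quotient_groupoid Q E p = E_class Q E p ` mu_cut Q E p"
  by (auto simp: quotient_groupoid_def quotient_def E_class_def)

text \<open>
  The bounds on \<open>mu E a\<close> and \<open>mu E c\<close> make the two classes nonempty; compatibility makes all members
  of the union defining \<^const>\<open>class_op\<close> coincide.
\<close>

lemma class_op_E_class:
  assumes "L_groupoid Q f E" "a \<in> Q" "c \<in> Q" "p \<le> mu E a" "p \<le> mu E c"
  shows "class_op Q f E p (E_class Q E p a) (E_class Q E p c) = E_class Q E p (f a c)"
proof -
  have eq: "L_equality Q E" and comp: "compatible Q E f" and cl: "closed_op Q f"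
    using assms(1) by (auto simp: L_groupoid_def)
  have same: "E_class Q E p (f x y) = E_class Q E p (f a c)"
    if "x \<in> E_class Q E p a" "y \<in> E_class Q E p c" for x y
  proof -
    have xy: "x \<in> Q" "y \<in> Q" "p \<le> E a x" "p \<le> E c y"
      using that by (auto simp: mem_E_class_iff)
    have "p \<le> E (f a c) (f x y)"
      using compatible_cut[OF comp] assms xy by blast
    then show ?thesis
      using E_class_eqI[OF eq] cl assms xy by (metis closed_op_def)
  qed
  have "a \<in> E_class Q E p a" "c \<in> E_class Q E p c"
    using assms by (auto simp: mem_E_class_iff mu_def)
  then show ?thesis
    unfolding class_op_def using same by blast
qed

section \<open>Left division\<close>

lemma left_solution_unique:
  assumes "L_quasigroup Q f E" "a \<in> Q" "b \<in> Q" "left_solution Q f E a b c"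
    "p \<le> mu E a" "p \<le> mu E b" "c1 \<in> Q" "p \<le> E (f a c1) b"
  shows "p \<le> E c c1"
proof -
  have "left_E_uniquely_solvable Q f E a b"
    using assms unfolding L_quasigroup_def by blast
  moreover have "p \<le> inf (mu E a) (mu E b)"
    using assms by simp
  ultimately show ?thesis
    using assms unfolding left_E_uniquely_solvable_def by blast
qed

text \<open>
  A single solution \<open>c\<close> serves all levels at which \<open>[a]\<close> and \<open>[b]\<close> are classes of the quotient:
  it satisfies the equation at least to that degree, which makes \<open>[c]\<close> a solution in the quotient,
  and \<open>E\<close>-unique solvability identifies every other class solution with \<open>[c]\<close>.
\<close>

lemma class_ldiv_eq_class_of_solution:
  assumes Qg: "L_quasigroup Q f E" and a: "a \<in> Q" and b: "b \<in> Q"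
    and p: "p \<le> inf (mu E a) (mu E b)" and c: "left_solution Q f E a b c"
  shows "class_ldiv Q f E p (E_class Q E p a) (E_class Q E p b) = E_class Q E p c"
proof -
  have G: "L_groupoid Q f E"
    using Qg by (simp add: L_quasigroup_def)
  then have eq: "L_equality Q E" and cl: "closed_op Q f"
    by (auto simp: L_groupoid_def)
  have pa: "p \<le> mu E a" and pb: "p \<le> mu E b"
    using p by auto
  have cQ: "c \<in> Q" and pc: "p \<le> mu E c" and acb: "p \<le> E (f a c) b"
    using c order_trans[OF p] by (auto simp: left_solution_def)
  show ?thesis
    unfolding class_ldiv_def
  proof (rule the_equality, intro conjI)
    show "E_class Q E p c \<in> quotient_groupoid Q E p"
      using cQ pc by (auto simp: quotient_groupoid_eq mu_cut_def)
    show "class_op Q f E p (E_class Q E p a) (E_class Q E p c) = E_class Q E p b"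
      using class_op_E_class[OF G a cQ pa pc] E_class_eqI[OF eq _ b acb] cl a cQ
      by (simp add: closed_op_def)
  next
    fix C
    assume C: "C \<in> quotient_groupoid Q E p \<and> class_op Q f E p (E_class Q E p a) C = E_class Q E p b"
    then obtain c1 where c1: "c1 \<in> Q" "p \<le> mu E c1" "C = E_class Q E p c1"
      by (auto simp: quotient_groupoid_eq mu_cut_def)
    have "E_class Q E p (f a c1) = E_class Q E p b"
      using C c1 class_op_E_class[OF G a _ pa] by simp
    moreover have "b \<in> E_class Q E p b"
      using b pb by (simp add: mem_E_class_iff mu_def)
    ultimately have "p \<le> E (f a c1) b"
      by (auto simp: mem_E_class_iff)
    then have "p \<le> E c c1"
      using left_solution_unique[OF Qg a b c pa pb] c1 by blast
    then show "C = E_class Q E p c"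
      using E_class_eqI[OF eq cQ] c1 by blast
  qed
qed

text \<open>
  At the level \<open>inf (mu E a) (mu E b)\<close>, membership in the class of a solution transfers everything
  that the definition of a solution demands; at a smaller level it would only give part of it.
\<close>

lemma choice_from_class_ldiv_is_left_solution:
  assumes Qg: "L_quasigroup Q f E" and a: "a \<in> Q" and b: "b \<in> Q"
    and p: "p = inf (mu E a) (mu E b)"
    and d: "d \<in> class_ldiv Q f E p (E_class Q E p a) (E_class Q E p b)"
  shows "left_solution Q f E a b d"
proof -
  have eq: "L_equality Q E" and comp: "compatible Q E f" and cl: "closed_op Q f"
    using Qg by (auto simp: L_quasigroup_def L_groupoid_def)
  obtain c where c: "left_solution Q f E a b c"
    using Qg a b unfolding L_quasigroup_def left_E_uniquely_solvable_def by blast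
  then have cQ: "c \<in> Q" and acb: "p \<le> E (f a c) b"
    using p by (auto simp: left_solution_def)
  have dQ: "d \<in> Q" and cd: "p \<le> E c d"
    using d class_ldiv_eq_class_of_solution[OF Qg a b _ c, of p] p by (auto simp: mem_E_class_iff)
  have dc: "p \<le> E d c"
    using cd L_equality_sym[OF eq cQ dQ] by simp
  have "p \<le> E a a"
    using p by (simp add: mu_def)
  then have "p \<le> E (f a d) (f a c)"
    using compatible_cut[OF comp a a dQ cQ] dc by blast
  moreover have "f a d \<in> Q" "f a c \<in> Q"
    using cl a cQ dQ by (auto simp: closed_op_def)
  ultimately have "p \<le> E (f a d) b"
    using L_equality_trans_cut[OF eq _ b] acb by blast
  then show ?thesis
    using dQ L_equality_le_mu(1)[OF eq dQ cQ dc] p by (simp add: left_solution_def)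
qed

context
  fixes Q :: "'a set" and f ld :: "'a \<Rightarrow> 'a \<Rightarrow> 'a" and E :: "'a \<Rightarrow> 'a \<Rightarrow> 'l::complete_lattice"
  assumes Qg: "L_quasigroup Q f E"
    and ld: "\<And>a b. a \<in> Q \<Longrightarrow> b \<in> Q \<Longrightarrow> left_solution Q f E a b (ld a b)"
begin

lemma left_division_closed: "closed_op Q ld"
  using ld by (simp add: closed_op_def left_solution_def)

lemma left_division_compatible: "compatible Q E ld"
  unfolding compatible_def
proof (intro ballI)
  fix a a' b b'
  assume Q: "a \<in> Q" "a' \<in> Q" "b \<in> Q" "b' \<in> Q"
  define p where "p = inf (E a a') (E b b')"
  have eq: "L_equality Q E" and comp: "compatible Q E f" and cl: "closed_op Q f"
    using Qg by (auto simp: L_quasigroup_def L_groupoid_def)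
  have paa': "p \<le> E a a'" and pbb': "p \<le> E b b'"
    by (auto simp: p_def)
  note mus = L_equality_le_mu[OF eq Q(1,2) paa'] L_equality_le_mu[OF eq Q(3,4) pbb']
  let ?c' = "ld a' b'"
  have sol': "?c' \<in> Q" "inf (mu E a') (mu E b') \<le> inf (mu E ?c') (E (f a' ?c') b')"
    using ld Q by (auto simp: left_solution_def)
  have "p \<le> inf (mu E a') (mu E b')"
    using mus by simp
  \<comment> \<open>That \<open>p\<close> is also below \<open>mu E ?c'\<close> is what lets \<open>a'\<close> be replaced by \<open>a\<close> in \<open>f a' ?c'\<close>.\<close>
  then have c': "p \<le> E ?c' ?c'" "p \<le> E (f a' ?c') b'"
    using order_trans[OF _ sol'(2)] by (auto simp: mu_def)
  have prods: "f a ?c' \<in> Q" "f a' ?c' \<in> Q"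
    using cl Q sol'(1) by (auto simp: closed_op_def)
  have "p \<le> E (f a ?c') (f a' ?c')"
    using compatible_cut[OF comp] Q sol'(1) paa' c'(1) by blast
  then have "p \<le> E (f a ?c') b'"
    using L_equality_trans_cut[OF eq] prods Q c'(2) by blast
  moreover have "p \<le> E b' b"
    using pbb' L_equality_sym[OF eq Q(3,4)] by simp
  ultimately have "p \<le> E (f a ?c') b"
    using L_equality_trans_cut[OF eq] prods Q by blast
  then show "inf (E a a') (E b b') \<le> E (ld a b) (ld a' b')"
    using left_solution_unique[OF Qg Q(1,3) ld[OF Q(1,3)]] mus sol'(1) unfolding p_def by blast
qed

lemma mult_left_division:
  assumes x: "x \<in> Q" and y: "y \<in> Q"
  shows "inf (mu E x) (mu E y) \<le> E y (f x (ld x y))"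
proof -
  have eq: "L_equality Q E" and cl: "closed_op Q f"
    using Qg by (auto simp: L_quasigroup_def L_groupoid_def)
  have "ld x y \<in> Q" "inf (mu E x) (mu E y) \<le> E (f x (ld x y)) y"
    using ld[OF x y] by (auto simp: left_solution_def)
  then show ?thesis
    using L_equality_sym[OF eq y, of "f x (ld x y)"] cl x by (simp add: closed_op_def)
qed

lemma left_division_mult:
  assumes x: "x \<in> Q" and y: "y \<in> Q"
  shows "inf (mu E x) (mu E y) \<le> E y (ld x (f x y))"
proof -
  have eq: "L_equality Q E" and comp: "compatible Q E f" and cl: "closed_op Q f"
    using Qg by (auto simp: L_quasigroup_def L_groupoid_def)
  define p where "p = inf (mu E x) (mu E y)"
  have xy: "f x y \<in> Q"
    using cl x y by (simp add: closed_op_def)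
  have px: "p \<le> mu E x" and py: "p \<le> mu E y"
    by (auto simp: p_def)
  then have pxy: "p \<le> E (f x y) (f x y)"
    using compatible_cut[OF comp x x y y] by (simp add: mu_def)
  have "p \<le> E (ld x (f x y)) y"
    using left_solution_unique[OF Qg x xy ld[OF x xy] px _ y pxy] pxy by (simp add: mu_def)
  then show ?thesis
    using L_equality_sym[OF eq y, of "ld x (f x y)"] ld[OF x xy]
    by (simp add: p_def left_solution_def)
qed

end

section \<open>Passing to the opposite groupoid\<close>

lemma closed_op_swap: "closed_op Q (\<lambda>x y. g y x) \<longleftrightarrow> closed_op Q g"
  by (auto simp: closed_op_def)

lemma compatible_swap: "compatible Q E (\<lambda>x y. g y x) \<longleftrightarrow> compatible Q E g"
proof -
  have "compatible Q E (\<lambda>x y. h y x)" if "compatible Q E h" for h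
    unfolding compatible_def
  proof (intro ballI)
    fix x y u v
    assume "x \<in> Q" "y \<in> Q" "u \<in> Q" "v \<in> Q"
    then have "inf (E u v) (E x y) \<le> E (h u x) (h v y)"
      using that by (simp add: compatible_def)
    then show "inf (E x y) (E u v) \<le> E (h u x) (h v y)"
      by (simp add: inf.commute)
  qed
  from this[of g] this[of "\<lambda>x y. g y x"] show ?thesis
    by blast
qed

lemma L_quasigroup_opposite:
  assumes "L_quasigroup Q f E"
  shows "L_quasigroup Q (\<lambda>x y. f y x) E"
proof -
  have sol: "left_solution Q (\<lambda>x y. f y x) E = right_solution Q f E"
    "right_solution Q (\<lambda>x y. f y x) E = left_solution Q f E"
    by (auto simp: fun_eq_iff left_solution_def right_solution_def)
  have "L_groupoid Q (\<lambda>x y. f y x) E"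
    \<comment> \<open>Uninstantiated, the two equations would match every binary operation and rewrite forever.\<close>
    using assms by (simp add: L_quasigroup_def L_groupoid_def
        closed_op_swap[of Q f] compatible_swap[of Q E f])
  then show ?thesis
    using assms
    by (simp add: L_quasigroup_def left_E_uniquely_solvable_def right_E_uniquely_solvable_def sol)
qed

lemma class_rdiv_eq_class_ldiv_opposite:
  "class_rdiv Q f E p B A = class_ldiv Q (\<lambda>x y. f y x) E p A B"
proof -
  have "class_op Q f E p D A = class_op Q (\<lambda>x y. f y x) E p A D" for D
    by (auto simp: class_op_def)
  then show ?thesis
    by (simp add: class_rdiv_def class_ldiv_def)
qed

section \<open>Quasigroups as equasigroups\<close>

theorem theorem6:
  fixes Q :: "'a set"
    and f ld rd :: "'a \<Rightarrow> 'a \<Rightarrow> 'a"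
    and E :: "'a \<Rightarrow> 'a \<Rightarrow> 'l::complete_lattice"
  assumes "L_groupoid Q f E"
    and "L_quasigroup Q f E"
    and "\<And>a b p. a \<in> Q \<Longrightarrow> b \<in> Q \<Longrightarrow> p = inf (mu E a) (mu E b) \<Longrightarrow>
           ld a b \<in> class_ldiv Q f E p (E_class Q E p a) (E_class Q E p b)"
    and "\<And>a b p. a \<in> Q \<Longrightarrow> b \<in> Q \<Longrightarrow> p = inf (mu E a) (mu E b) \<Longrightarrow>
           rd b a \<in> class_rdiv Q f E p (E_class Q E p b) (E_class Q E p a)"
  shows "L_equasigroup Q f ld rd E"
proof -
  let ?g = "\<lambda>x y. f y x" and ?rd' = "\<lambda>x y. rd y x"
  note Qg = assms(2) and Qg' = L_quasigroup_opposite[OF assms(2)]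
  have ld: "left_solution Q f E a b (ld a b)" if "a \<in> Q" "b \<in> Q" for a b
    using choice_from_class_ldiv_is_left_solution[OF Qg that refl] assms(3)[OF that refl] .
  have rd: "left_solution Q ?g E a b (?rd' a b)" if "a \<in> Q" "b \<in> Q" for a b
    using choice_from_class_ldiv_is_left_solution[OF Qg' that refl] assms(4)[OF that refl]
    unfolding class_rdiv_eq_class_ldiv_opposite .
  have left: "closed_op Q ld" "compatible Q E ld"
    by (rule left_division_closed[OF Qg ld] left_division_compatible[OF Qg ld]; assumption)+
  have "closed_op Q ?rd'" "compatible Q E ?rd'"
    by (rule left_division_closed[OF Qg' rd] left_division_compatible[OF Qg' rd]; assumption)+
  then have right: "closed_op Q rd" "compatible Q E rd"
    unfolding closed_op_swap[of Q rd] compatible_swap[of Q E rd] .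
  have left_laws: "inf (mu E x) (mu E y) \<le> E y (f x (ld x y))"
    "inf (mu E x) (mu E y) \<le> E y (ld x (f x y))" if "x \<in> Q" "y \<in> Q" for x y
    using mult_left_division[OF Qg ld that] left_division_mult[OF Qg ld that] by simp_all
  have right_laws: "inf (mu E x) (mu E y) \<le> E y (f (rd y x) x)"
    "inf (mu E x) (mu E y) \<le> E y (rd (f y x) x)" if "x \<in> Q" "y \<in> Q" for x y
    using mult_left_division[OF Qg' rd that] left_division_mult[OF Qg' rd that] by simp_all
  show ?thesis
    using assms(1) left right left_laws right_laws by (simp add: L_equasigroup_def L_groupoid_def)
qed

end
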